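(* Let $N$ be a positive integer, let $G$ be a graph with $n \le N$ vertices, regarded as a subgraph of the complete graph $K_N$, and let $0<k\le N$. For integers $j,m\ge 0$ let $b_{j,m,n}$ be the number of ways of choosing $m$ pairwise disjoint bad components (an unordered collection) of $K_N^{-G}$ such that the cardinality of the union of the vertex sets of the chosen bad components is $j$. Then $$C^k(K_N^{-G}) = \sum_{j=0}^{n}\sum_{m=0}^{j}(-1)^m\, b_{j,m,n}\, S(N-j,k-m).$$
   Context: Graphs are finite and simple. A graph composition of a graph $H$ is a partition of $V(H)$ into nonempty blocks (called components) each of which induces a connected subgraph of $H$. $C^k(H)$ denotes the number of graph compositions of $H$ with exactly $k$ components. For a subgraph $G$ of $K_N$, $K_N^{-G}$ is the graph with vertex set $V(K_N)$ and edge set $E(K_N)\setminus E(G)$. A bad component of $K_N^{-G}$ is a nonempty set $B\subseteq V(G)$ such that the complement of $G$, restricted to $B$ (i.e. the subgraph of the complement of $G$ induced by $B$), is disconnected. $S(a,b)$ is the Stirling number of the second kind, the number of partitions of an $a$-element set into exactly $b$ nonempty subsets, with $S(0,0)=1$, $S(a,0)=0$ for $a\ge1$, and $S(a,b)=0$ if $b<0$ or $b>a$. *)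

theory Defs
  imports "Graph_Theory.Graph_Theory" "HOL-Combinatorics.Stirling" "HOL-Library.Disjoint_Sets"
begin

text \<open>
  A finite simple graph is a \<^locale>\<open>pair_graph\<close>, that is, a finite loop-free digraph with a
  symmetric arc set; an undirected edge is represented by its two arcs. On such graphs
  \<^const>\<open>connected\<close> is ordinary connectedness (and requires a nonempty vertex set).
\<close>

definition graph_compositions :: "'a pair_pre_digraph \<Rightarrow> 'a set set set" where
  "graph_compositions H = {P. partition_on (pverts H) P \<and> (\<forall>B\<in>P. connected (with_proj H \<restriction> B))}"

definition num_compositions :: "nat \<Rightarrow> 'a pair_pre_digraph \<Rightarrow> nat" where
  "num_compositions k H = card {P \<in> graph_compositions H. card P = k}"

definition delete_edges :: "'a pair_pre_digraph \<Rightarrow> 'a pair_pre_digraph \<Rightarrow> 'a pair_pre_digraph" where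
  "delete_edges K G = \<lparr>pverts = pverts K, parcs = parcs K - parcs G\<rparr>"

definition graph_complement :: "'a pair_pre_digraph \<Rightarrow> 'a pair_pre_digraph" where
  "graph_complement G = \<lparr>pverts = pverts G,
     parcs = {(u, v). u \<in> pverts G \<and> v \<in> pverts G \<and> u \<noteq> v \<and> (u, v) \<notin> parcs G}\<rparr>"

definition bad_component :: "'a pair_pre_digraph \<Rightarrow> 'a set \<Rightarrow> bool" where
  "bad_component G B \<longleftrightarrow>
     B \<noteq> {} \<and> B \<subseteq> pverts G \<and> \<not> connected (with_proj (graph_complement G) \<restriction> B)"

definition num_bad_choices :: "'a pair_pre_digraph \<Rightarrow> nat \<Rightarrow> nat \<Rightarrow> nat" where
  "num_bad_choices G j m =
     card {F. (\<forall>B\<in>F. bad_component G B) \<and> disjoint F \<and> card F = m \<and> card (\<Union>F) = j}"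

text \<open>
  The lower argument is an integer: truncated subtraction in it would turn \<open>S 0 (k - m)\<close> with
  \<open>m > k\<close> into \<open>S 0 0 = 1\<close>.
\<close>

definition Stirling_int :: "nat \<Rightarrow> int \<Rightarrow> nat" where
  "Stirling_int a b = (if b < 0 then 0 else Stirling a (nat b))"

lemma partitions_insert:
  assumes "finite A" "x \<notin> A"
  shows "{P. partition_on (insert x A) P \<and> card P = Suc k} =
    insert {x} ` {P. partition_on A P \<and> card P = k} \<union>
    (\<Union>Q\<in>{P. partition_on A P \<and> card P = Suc k}. (\<lambda>B. insert (insert x B) (Q - {B})) ` Q)"
    (is "?L = ?R1 \<union> ?R2")
proof (intro equalityI subsetI)
  fix P assume "P \<in> ?L"
  then have P: "partition_on (insert x A) P" "card P = Suc k" by auto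
  have finP: "finite P" using P(2) by (metis card.infinite nat.distinct(1))
  obtain C where C: "C \<in> P" "x \<in> C" using P(1) by (auto simp: partition_on_def)
  have uniq: "D = C" if "D \<in> P" "x \<in> D" for D
    using that C P(1) by (auto simp: partition_on_def disjoint_def)
  have dj: "D \<inter> C = {}" if "D \<in> P" "D \<noteq> C" for D
    using that C P(1) by (auto simp: partition_on_def disjoint_def)
  show "P \<in> ?R1 \<union> ?R2"
  proof (cases "C = {x}")
    case True
    have U: "\<Union>(P - {C}) = A"
      using P(1) True uniq C assms(2) unfolding partition_on_def by fast
    have "partition_on A (P - {C})"
      using P(1) U by (auto simp: partition_on_def disjoint_def)
    moreover have "card (P - {C}) = k" using P(2) C finP by simp
    moreover have "P = insert {x} (P - {C})" using C True by auto
    ultimately show ?thesis by blast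
  next
    case False
    define B where "B = C - {x}"
    have B: "B \<noteq> {}" "x \<notin> B" "insert x B = C" using False C by (auto simp: B_def)
    have BP: "B \<notin> P" using dj[of B] B by auto
    define Q where "Q = insert B (P - {C})"
    have U: "\<Union>Q = A"
    proof
      show "\<Union>Q \<subseteq> A"
      proof
        fix a assume "a \<in> \<Union>Q"
        then consider "a \<in> B" | D where "D \<in> P" "D \<noteq> C" "a \<in> D" unfolding Q_def by blast
        then have "a \<in> \<Union>P \<and> a \<noteq> x"
        proof cases
          case 1
          then show ?thesis using C(1) by (auto simp: B_def)
        next
          case 2
          then show ?thesis using uniq by blast
        qed
        then show "a \<in> A" using P(1) by (auto simp: partition_on_def)
      qed
      show "A \<subseteq> \<Union>Q"
      proof
        fix a assume "a \<in> A"
        then have "a \<noteq> x" "a \<in> \<Union>P" using assms(2) P(1) by (auto simp: partition_on_def)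
        then show "a \<in> \<Union>Q" unfolding Q_def B_def by blast
      qed
    qed
    have dB: "D \<inter> B = {}" if "D \<in> P - {C}" for D using dj[of D] that B(3) by blast
    have "disjoint Q" unfolding Q_def
      using P(1) dB by (auto simp: partition_on_def pairwise_insert disjnt_def pairwise_def)
    then have "partition_on A Q"
      using P(1) U B(1) by (auto simp: partition_on_def Q_def)
    moreover have "card Q = Suc k" using P(2) C finP BP by (simp add: Q_def)
    moreover have "B \<in> Q" by (simp add: Q_def)
    moreover have "P = insert (insert x B) (Q - {B})" using C B BP by (auto simp: Q_def)
    ultimately show ?thesis by blast
  qed
next
  fix P assume "P \<in> ?R1 \<union> ?R2"
  then show "P \<in> ?L"
  proof
    assume "P \<in> ?R1"
    then obtain Q where Q: "partition_on A Q" "card Q = k" "P = insert {x} Q" by auto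
    have fin: "finite Q" using Q(1) assms(1) finite_elements by blast
    have "x \<notin> \<Union>Q" using Q(1) assms(2) by (auto simp: partition_on_def)
    then show ?thesis using Q fin
      by (auto simp: partition_on_def pairwise_insert disjnt_def)
  next
    assume "P \<in> ?R2"
    then obtain Q B where Q: "partition_on A Q" "card Q = Suc k" "B \<in> Q"
      "P = insert (insert x B) (Q - {B})" by auto
    have fin: "finite Q" using Q(1) assms(1) finite_elements by blast
    have x: "x \<notin> \<Union>Q" using Q(1) assms(2) by (auto simp: partition_on_def)
    then have "insert x B \<notin> Q" by auto
    then have c: "card P = Suc k" using Q fin by simp
    have "D \<inter> insert x B = {}" if "D \<in> Q - {B}" for D
      using that Q x by (auto simp: partition_on_def disjoint_def)
    then have "disjoint P"
      using Q by (auto simp: partition_on_def pairwise_insert disjnt_def pairwise_def)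
    moreover have "\<Union>P = insert x A" using Q by (auto simp: partition_on_def)
    moreover have "{} \<notin> P" using Q by (auto simp: partition_on_def)
    ultimately show ?thesis using c by (simp add: partition_on_def)
  qed
qed

lemma finite_partitions: "finite A \<Longrightarrow> finite {P. partition_on A P \<and> card P = k}"
  by (rule finite_subset[of _ "Pow (Pow A)"]) (auto simp: partition_on_def)

lemma card_partitions_insert:
  assumes "finite A" "x \<notin> A"
  shows "card {P. partition_on (insert x A) P \<and> card P = Suc k} =
    Suc k * card {P. partition_on A P \<and> card P = Suc k} + card {P. partition_on A P \<and> card P = k}"
proof -
  let ?p = "\<lambda>k. {P. partition_on A P \<and> card P = k}"
  let ?f = "\<lambda>Q B. insert (insert x B) (Q - {B})"
  have x: "x \<notin> C" if "C \<in> Q" "partition_on A Q" for C Q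
    using that assms(2) by (auto simp: partition_on_def)
  have rec1: "insert {x} Q - {{x}} = Q" if "partition_on A Q" for Q
    using x[of "{x}" Q] that by auto
  have inj1: "inj_on (insert {x}) (?p k)"
    by (rule inj_onI) (metis (mono_tags, lifting) mem_Collect_eq rec1)
  have the: "\<Union>{C \<in> ?f Q B. x \<in> C} - {x} = B" and rest: "{C \<in> ?f Q B. x \<notin> C} = Q - {B}"
    if "Q \<in> ?p (Suc k)" "B \<in> Q" for Q B
  proof -
    have "{C \<in> ?f Q B. x \<in> C} = {insert x B}" using x that by auto
    then show "\<Union>{C \<in> ?f Q B. x \<in> C} - {x} = B" using x that by auto
    show "{C \<in> ?f Q B. x \<notin> C} = Q - {B}" using x that by auto
  qed
  have inj: "Q = Q' \<and> B = B'"
    if "Q \<in> ?p (Suc k)" "B \<in> Q" "Q' \<in> ?p (Suc k)" "B' \<in> Q'" "?f Q B = ?f Q' B'" for Q B Q' B'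
  proof -
    have "B = B'" using the[OF that(1,2)] the[OF that(3,4)] that(5) by simp
    moreover have "Q - {B} = Q' - {B'}" using rest[OF that(1,2)] rest[OF that(3,4)] that(5) by simp
    ultimately show ?thesis using that by blast
  qed
  have fin: "finite Q" if "Q \<in> ?p (Suc k)" for Q using that assms(1) finite_elements by blast
  have cimg: "card (?f Q ` Q) = Suc k" if "Q \<in> ?p (Suc k)" for Q
  proof -
    have "inj_on (?f Q) Q" using inj that by (intro inj_onI) blast
    then show ?thesis using that by (simp add: card_image)
  qed
  have "card (\<Union>Q\<in>?p (Suc k). ?f Q ` Q) = (\<Sum>Q\<in>?p (Suc k). card (?f Q ` Q))"
  proof (rule card_UN_disjoint)
    show "\<forall>Q\<in>?p (Suc k). \<forall>Q'\<in>?p (Suc k). Q \<noteq> Q' \<longrightarrow> ?f Q ` Q \<inter> ?f Q' ` Q' = {}"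
    proof (intro ballI impI)
      fix Q Q' assume q: "Q \<in> ?p (Suc k)" "Q' \<in> ?p (Suc k)" "Q \<noteq> Q'"
      show "?f Q ` Q \<inter> ?f Q' ` Q' = {}"
      proof (rule ccontr)
        assume "?f Q ` Q \<inter> ?f Q' ` Q' \<noteq> {}"
        then obtain B B' where "B \<in> Q" "B' \<in> Q'" "?f Q B = ?f Q' B'" by blast
        then show False using inj[of Q B Q' B'] q by simp
      qed
    qed
    show "finite (?p (Suc k))" by (rule finite_partitions[OF assms(1)])
    show "\<forall>Q\<in>?p (Suc k). finite (?f Q ` Q)" using fin by blast
  qed
  also have "\<dots> = Suc k * card (?p (Suc k))" using cimg by simp
  finally have c2: "card (\<Union>Q\<in>?p (Suc k). ?f Q ` Q) = Suc k * card (?p (Suc k))" .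
  have "{x} \<notin> ?f Q B" if "Q \<in> ?p (Suc k)" "B \<in> Q" for Q B
  proof
    assume "{x} \<in> ?f Q B"
    then have "{x} = insert x B" using x that by auto
    then have "B = {}" using x that by auto
    then show False using that by (auto simp: partition_on_def)
  qed
  then have dis: "insert {x} ` ?p k \<inter> (\<Union>Q\<in>?p (Suc k). ?f Q ` Q) = {}" by blast
  have "card (insert {x} ` ?p k \<union> (\<Union>Q\<in>?p (Suc k). ?f Q ` Q)) =
      card (insert {x} ` ?p k) + card (\<Union>Q\<in>?p (Suc k). ?f Q ` Q)"
  proof (rule card_Un_disjoint)
    show "finite (insert {x} ` ?p k)" by (intro finite_imageI finite_partitions assms(1))
    show "finite (\<Union>Q\<in>?p (Suc k). ?f Q ` Q)"
      by (intro finite_UN_I finite_imageI finite_partitions assms(1)) (rule fin)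
  qed (rule dis)
  then show ?thesis
    unfolding partitions_insert[OF assms] c2 by (simp add: card_image[OF inj1])
qed

lemma card_partitions_Stirling:
  "finite A \<Longrightarrow> card {P. partition_on A P \<and> card P = k} = Stirling (card A) k"
proof (induction A arbitrary: k rule: finite_induct)
  case empty
  have "{P::'a set set. P = {} \<and> card P = k} = (if k = 0 then {{}} else {})" by auto
  then show ?case by (cases k) (simp_all add: partition_on_empty)
next
  case (insert x A)
  show ?case
  proof (cases k)
    case 0
    have "\<not> (partition_on (insert x A) P \<and> card P = 0)" for P
      using finite_elements[of "insert x A" P] insert.hyps(1) partition_on_empty
      by (metis card_eq_0_iff finite_insert insert_not_empty partition_onD1 Union_empty)
    then have "{P. partition_on (insert x A) P \<and> card P = 0} = {}" by blast
    then show ?thesis using 0 insert.hyps by (simp del: Collect_empty_eq)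
  next
    case (Suc k')
    then show ?thesis using insert by (simp add: card_partitions_insert)
  qed
qed

lemma card_partitions_Stirling_int:
  assumes "finite A"
  shows "card {P. partition_on A P \<and> int (card P) = b} = Stirling_int (card A) b"
proof (cases "b < 0")
  case True
  then have "\<And>P :: 'a set set. int (card P) \<noteq> b" by linarith
  then show ?thesis using True by (simp add: Stirling_int_def)
next
  case False
  then have "\<And>P :: 'a set set. int (card P) = b \<longleftrightarrow> card P = nat b" by linarith
  then show ?thesis using False card_partitions_Stirling[OF assms] by (simp add: Stirling_int_def)
qed

end

theory Submission
  imports Defs
begin

text \<open>
  The compositions of \<open>K - G\<close> are the partitions of the vertex set without a bad block: a block
  with a vertex outside \<open>G\<close> is connected through that vertex, and on the remaining blocks \<open>K - G\<close>
  agrees with the complement of \<open>G\<close>. Inclusion-exclusion over the set \<open>F\<close> of prescribed bad blocks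
  gives the formula, since the partitions containing \<open>F\<close> are determined by a partition of the
  vertices outside \<open>\<Union>F\<close>.
\<close>

text \<open>Expanding the product of the factors 1 - 1 over \<open>A\<close> gives this sum; the
  empty product is 1. Taken over the bad blocks of a partition, it is the indicator that there are
  none.\<close>

lemma sum_minus_one_power_card_Pow:
  assumes "finite A"
  shows "(\<Sum>X\<in>Pow A. (-1) ^ card X) = (if A = {} then 1 else 0 :: 'a :: comm_ring_1)"
  using prod_diff_conv_sum[OF assms, of "\<lambda>_. 1" "\<lambda>_. 1 :: 'a"] assms
  by (simp add: power_0_left)

text \<open>Removing \<open>F\<close> undoes adding it: in a partition containing \<open>F\<close>,
  the other blocks miss \<open>\<Union>F\<close> and hence cover exactly
  \<open>V - \<Union>F\<close>.\<close>

lemma bij_betw_partitions_containing: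
  assumes F: "disjoint F" "{} \<notin> F" "\<Union>F \<subseteq> V"
  shows "bij_betw (\<lambda>Q. Q \<union> F) {Q. partition_on (V - \<Union>F) Q} {P. partition_on V P \<and> F \<subseteq> P}"
proof (rule bij_betw_byWitness[where f' = "\<lambda>P. P - F"])
  \<comment> \<open>A common block would lie both in \<open>V - \<Union>F\<close> and in
    \<open>\<Union>F\<close>, hence be empty, which \<open>F\<close> excludes.\<close>
  have dis: "Q \<inter> F = {}" if "partition_on (V - \<Union>F) Q" for Q
  proof -
    have "B = {}" if "B \<in> Q" "B \<in> F" for B
      using that \<open>partition_on (V - \<Union>F) Q\<close> by (auto simp: partition_on_def)
    then show ?thesis using F(2) by blast
  qed
  then show "\<forall>Q\<in>{Q. partition_on (V - \<Union>F) Q}. Q \<union> F - F = Q" by blast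
  show "\<forall>P\<in>{P. partition_on V P \<and> F \<subseteq> P}. P - F \<union> F = P" by blast
  show "(\<lambda>Q. Q \<union> F) ` {Q. partition_on (V - \<Union>F) Q} \<subseteq> {P. partition_on V P \<and> F \<subseteq> P}"
  proof clarsimp
    fix Q assume Q: "partition_on (V - \<Union>F) Q"
    have "disjoint (Q \<union> F)"
      using Q F(1) by (intro disjoint_union) (auto simp: partition_on_def)
    then show "partition_on V (Q \<union> F)"
      using Q F by (auto simp: partition_on_def)
  qed
  show "(\<lambda>P. P - F) ` {P. partition_on V P \<and> F \<subseteq> P} \<subseteq> {Q. partition_on (V - \<Union>F) Q}"
  proof clarsimp
    fix P assume P: "partition_on V P" "F \<subseteq> P"
    have "B \<inter> C = {}" if "B \<in> P - F" "C \<in> F" for B C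
    proof -
      have "B \<noteq> C" using that by blast
      then show ?thesis using that P by (auto simp: partition_on_def disjoint_def)
    qed
    then have "\<Union>(P - F) = \<Union>P - \<Union>F" using P(2) by blast
    then show "partition_on (V - \<Union>F) (P - F)"
      using P by (auto simp: partition_on_def intro: pairwise_subset)
  qed
qed

lemma card_partitions_containing:
  assumes V: "finite V" and F: "disjoint F" "{} \<notin> F" "\<Union>F \<subseteq> V"
  shows "card {P. partition_on V P \<and> card P = k \<and> F \<subseteq> P} =
    Stirling_int (card V - card (\<Union>F)) (int k - int (card F))"
proof -
  have finF: "finite F" using V F(3) by (metis finite_UnionD finite_subset)
  have card_Un: "card (Q \<union> F) = card Q + card F" if "partition_on (V - \<Union>F) Q" for Q
  proof (rule card_Un_disjoint)
    show "finite Q" using that V finite_elements by blast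
    have "B = {}" if "B \<in> Q" "B \<in> F" for B
      using that \<open>partition_on (V - \<Union>F) Q\<close> by (auto simp: partition_on_def)
    then show "Q \<inter> F = {}" using F(2) by blast
  qed (rule finF)
  \<comment> \<open>The size condition is stated over the integers, so that for
    \<open>card F > k\<close> both sides are empty instead of \<open>k - card F\<close> being cut
    off at 0.\<close>
  have "bij_betw (\<lambda>Q. Q \<union> F) {Q \<in> {Q. partition_on (V - \<Union>F) Q}. int (card Q) = int k - int (card F)}
      {P \<in> {P. partition_on V P \<and> F \<subseteq> P}. card P = k}"
    by (rule bij_betw_Collect[OF bij_betw_partitions_containing[OF F]]) (auto simp: card_Un)
  then have "card {Q. partition_on (V - \<Union>F) Q \<and> int (card Q) = int k - int (card F)} =
      card {P. partition_on V P \<and> card P = k \<and> F \<subseteq> P}"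
    by (auto dest!: bij_betw_same_card simp: conj_ac)
  then show ?thesis
    using card_partitions_Stirling_int[of "V - \<Union>F"] V F(3)
    by (simp add: card_Diff_subset finite_subset)
qed

lemma card_partitions_avoiding:
  assumes V: "finite V" and bad: "\<And>B. bad B \<Longrightarrow> B \<noteq> {} \<and> B \<subseteq> V"
  shows "int (card {P. partition_on V P \<and> card P = k \<and> (\<forall>B\<in>P. \<not> bad B)}) =
    (\<Sum>F | (\<forall>B\<in>F. bad B) \<and> disjoint F.
      (-1) ^ card F * int (Stirling_int (card V - card (\<Union>F)) (int k - int (card F))))"
proof -
  let ?Ps = "{P. partition_on V P \<and> card P = k}"
  let ?Fs = "{F. (\<forall>B\<in>F. bad B) \<and> disjoint F}"
  have fin_Ps: "finite ?Ps" by (rule finite_partitions[OF V])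
  have fin_Fs: "finite ?Fs"
    by (rule finite_subset[of _ "Pow (Pow V)"]) (use V bad in auto)
  have "int (card {P. partition_on V P \<and> card P = k \<and> (\<forall>B\<in>P. \<not> bad B)}) =
      int (card {P \<in> ?Ps. {B \<in> P. bad B} = {}})"
    by (intro arg_cong[of _ _ "\<lambda>X. int (card X)"]) blast
  also have "\<dots> = (\<Sum>P\<in>?Ps. if {B \<in> P. bad B} = {} then 1 else 0)"
    using fin_Ps by (simp add: sum.If_cases Int_def)
  \<comment> \<open>The indicator becomes an alternating sum over the sets of bad blocks of
    \<open>P\<close>.\<close>
  also have "\<dots> = (\<Sum>P\<in>?Ps. \<Sum>F\<in>Pow {B \<in> P. bad B}. (-1) ^ card F)"
    by (intro sum.cong refl sum_minus_one_power_card_Pow[symmetric])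
      (auto intro: finite_subset[OF _ finite_elements[OF V]])
  \<comment> \<open>Any set of blocks of \<open>P\<close> is pairwise disjoint, so the sets of bad
    blocks of \<open>P\<close> are exactly the members of \<open>?Fs\<close> contained in
    \<open>P\<close>. With \<open>?Fs\<close> independent of \<open>P\<close>, the two sums can be
    exchanged.\<close>
  also have "\<dots> = (\<Sum>P\<in>?Ps. \<Sum>F | F \<in> ?Fs \<and> F \<subseteq> P. (-1) ^ card F)"
    by (intro sum.cong refl) (auto simp: partition_on_def intro: pairwise_subset)
  also have "\<dots> = (\<Sum>F\<in>?Fs. \<Sum>P | P \<in> ?Ps \<and> F \<subseteq> P. (-1) ^ card F)"
    by (rule sum.swap_restrict[OF fin_Ps fin_Fs])
  also have "\<dots> = (\<Sum>F\<in>?Fs.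
      (-1) ^ card F * int (Stirling_int (card V - card (\<Union>F)) (int k - int (card F))))"
  proof (rule sum.cong)
    \<comment> \<open>The summand does not depend on \<open>P\<close>, so the inner sum is the sign
      times the number of partitions into \<open>k\<close> blocks that contain
      \<open>F\<close>.\<close>
    fix F assume "F \<in> ?Fs"
    then have "disjoint F" "{} \<notin> F" "\<Union>F \<subseteq> V" using bad by blast+
    from card_partitions_containing[OF V this, of k]
    show "(\<Sum>P | P \<in> ?Ps \<and> F \<subseteq> P. (-1) ^ card F) =
        (-1) ^ card F * int (Stirling_int (card V - card (\<Union>F)) (int k - int (card F)))"
      by (simp add: conj_ac mult.commute)
  qed simp
  finally show ?thesis .
qed

text \<open>Each member contributes at least one element, and disjointness makes the sizes add up.
  This bounds the index \<open>m\<close> by \<open>j\<close> in the final sum.\<close>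

lemma card_le_card_Union:
  assumes "finite (\<Union>F)" "disjoint F" "{} \<notin> F"
  shows "card F \<le> card (\<Union>F)"
proof -
  have "1 \<le> card B" if "B \<in> F" for B
    using that assms by (metis Suc_leI One_nat_def card_gt_0_iff finite_UnionD finite_Union
        Sup_upper finite_subset)
  then have "(\<Sum>B\<in>F. 1) \<le> (\<Sum>B\<in>F. card B)" by (intro sum_mono)
  also have "\<dots> = card (\<Union>F)"
    using assms by (intro card_Union_disjoint[symmetric]) (auto intro: finite_subset)
  finally show ?thesis by simp
qed

text \<open>Any two vertices are joined by a walk through \<open>v\<close>. Arcs into
  \<open>v\<close> suffice because \<open>connected\<close> refers to the symmetric closure, which
  supplies the reverse arcs.\<close>

lemma connected_if_dominating_vertex:
  assumes v: "v \<in> verts H"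
    and dom: "\<And>u. u \<in> verts H \<Longrightarrow> u \<noteq> v \<Longrightarrow> (u, v) \<in> arcs_ends H"
  shows "connected H"
proof -
  let ?V = "verts H" and ?A = "arcs_ends (with_proj (mk_symmetric H))"
  have A: "(u, v) \<in> ?A" "(v, u) \<in> ?A" if "u \<in> ?V" "u \<noteq> v" for u
    using dom[OF that] by (auto simp: parcs_mk_symmetric)
  have "(u, v) \<in> rtrancl_on ?V ?A" "(v, u) \<in> rtrancl_on ?V ?A" if "u \<in> ?V" for u
    using that v A[OF that] by (cases "u = v"; auto intro: rtrancl_on_into_rtrancl_on)+
  then have "(u, w) \<in> rtrancl_on ?V ?A" if "u \<in> ?V" "w \<in> ?V" for u w
    using that by (meson rtrancl_on_trans)
  then show ?thesis
    using v by (auto simp: connected_def strongly_connected_def reachable_def)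
qed

lemma connected_delete_edges_complete_iff:
  assumes K: "parcs K = {(u, v). u \<in> pverts K \<and> v \<in> pverts K \<and> u \<noteq> v}"
    and G: "pverts G \<subseteq> pverts K" "parcs G \<subseteq> pverts G \<times> pverts G"
    and B: "B \<subseteq> pverts K" "B \<noteq> {}"
  shows "connected (with_proj (delete_edges K G) \<restriction> B) \<longleftrightarrow> \<not> bad_component G B"
proof (cases "B \<subseteq> pverts G")
  case True
  \<comment> \<open>On \<open>B\<close> both graphs have as arcs all pairs of distinct vertices that
    are not arcs of \<open>G\<close>, since \<open>K\<close> is complete.\<close>
  have "with_proj (delete_edges K G) \<restriction> B = with_proj (graph_complement G) \<restriction> B"
    using True K G by (auto simp: induce_subgraph_def delete_edges_def graph_complement_def)
  then show ?thesis using True B by (simp add: bad_component_def)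
next
  case False
  then obtain v where v: "v \<in> B" "v \<notin> pverts G" by blast
  \<comment> \<open>No arc of \<open>G\<close> touches \<open>v\<close>, so every arc of
    \<open>K\<close> at \<open>v\<close> survives the deletion and \<open>v\<close> is adjacent to
    all of \<open>B\<close>.\<close>
  have "connected (with_proj (delete_edges K G) \<restriction> B)"
  proof (rule connected_if_dominating_vertex)
    show "v \<in> verts (with_proj (delete_edges K G) \<restriction> B)" using v by simp
    fix u assume "u \<in> verts (with_proj (delete_edges K G) \<restriction> B)" "u \<noteq> v"
    then show "(u, v) \<in> arcs_ends (with_proj (delete_edges K G) \<restriction> B)"
      using v K G B by (auto simp: delete_edges_def arcs_ends_def arc_to_ends_def)
  qed
  then show ?thesis using False by (simp add: bad_component_def)
qed

theorem theorem5:
  fixes K G :: "'a pair_pre_digraph" and N n k :: nat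
  assumes "0 < N"
    and "complete_digraph N (with_proj K)"
    and "pair_graph G"
    and "subgraph (with_proj G) (with_proj K)"
    and "card (pverts G) = n"
    and "n \<le> N"
    and "0 < k" and "k \<le> N"
  shows "int (num_compositions k (delete_edges K G)) =
    (\<Sum>j=0..n. \<Sum>m=0..j. (-1) ^ m * int (num_bad_choices G j m)
      * int (Stirling_int (N - j) (int k - int m)))"
proof -
  interpret G: pair_graph G by fact
  have K: "finite (pverts K)" "card (pverts K) = N"
    "parcs K = {(u, v). u \<in> pverts K \<and> v \<in> pverts K \<and> u \<noteq> v}"
    using assms(2) by (auto simp: complete_digraph_pair_def)
  have GK: "pverts G \<subseteq> pverts K" using assms(4) by (auto simp: subgraph_def)
  have arcs_G: "parcs G \<subseteq> pverts G \<times> pverts G"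
    using G.in_arcsD1 G.in_arcsD2 by auto
  let ?Fs = "{F. (\<forall>B\<in>F. bad_component G B) \<and> disjoint F}"
  let ?I = "SIGMA j:{0..n}. {0..j}"
  let ?t = "\<lambda>j m. (-1) ^ m * int (Stirling_int (N - j) (int k - int m))"
  have bad: "B \<noteq> {} \<and> B \<subseteq> pverts G" if "bad_component G B" for B
    using that by (simp add: bad_component_def)
  have fin_Fs: "finite ?Fs"
    by (rule finite_subset[of _ "Pow (Pow (pverts G))"]) (use bad in auto)
  have "graph_compositions (delete_edges K G) =
      {P. partition_on (pverts K) P \<and> (\<forall>B\<in>P. \<not> bad_component G B)}"
  proof -
    have "connected (with_proj (delete_edges K G) \<restriction> B) \<longleftrightarrow> \<not> bad_component G B"
      if "partition_on (pverts K) P" "B \<in> P" for P B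
      using that by (intro connected_delete_edges_complete_iff K GK arcs_G)
        (auto simp: partition_on_def)
    moreover have "pverts (delete_edges K G) = pverts K" by (simp add: delete_edges_def)
    ultimately show ?thesis by (auto simp: graph_compositions_def)
  qed
  then have "int (num_compositions k (delete_edges K G)) =
      int (card {P. partition_on (pverts K) P \<and> card P = k \<and> (\<forall>B\<in>P. \<not> bad_component G B)})"
    by (simp add: num_compositions_def conj_ac)
  also have "\<dots> = (\<Sum>F\<in>?Fs. ?t (card (\<Union>F)) (card F))"
    using card_partitions_avoiding[OF K(1), of "bad_component G" k] bad GK K(2) by fastforce
  \<comment> \<open>The families are grouped by the pair of the size of their union and their number
    of members.\<close>
  also have "\<dots> = (\<Sum>z\<in>?I. \<Sum>F | F \<in> ?Fs \<and> (card (\<Union>F), card F) = z.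
      ?t (card (\<Union>F)) (card F))"
  proof -
    \<comment> \<open>No family is lost: its union lies in \<open>pverts G\<close>, which gives j
      \<le> n, and its members are nonempty and disjoint, which gives m \<le> j.\<close>
    have "(card (\<Union>F), card F) \<in> ?I" if "F \<in> ?Fs" for F
    proof -
      have U: "\<Union>F \<subseteq> pverts G" "{} \<notin> F" using that bad by blast+
      moreover have "finite (\<Union>F)" using U(1) G.pair_finite_verts by (rule finite_subset)
      ultimately show ?thesis
        using that card_le_card_Union[of F] card_mono[of "pverts G" "\<Union>F"] assms(5) by auto
    qed
    then have "(\<lambda>F. (card (\<Union>F), card F)) ` ?Fs \<subseteq> ?I" by blast
    then show ?thesis by (intro sum.group[symmetric] fin_Fs) auto
  qed
  also have "\<dots> = (\<Sum>(j, m)\<in>?I. (-1) ^ m * int (num_bad_choices G j m)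
      * int (Stirling_int (N - j) (int k - int m)))"
  proof (rule sum.cong)
    fix z :: "nat \<times> nat"
    obtain j m where z: "z = (j, m)" by (rule prod.exhaust)
    \<comment> \<open>On each group the term is constant, and the size of the group is
      \<open>num_bad_choices G j m\<close>.\<close>
    have "(\<Sum>F | F \<in> ?Fs \<and> (card (\<Union>F), card F) = z. ?t (card (\<Union>F)) (card F)) =
        (\<Sum>F | F \<in> ?Fs \<and> (card (\<Union>F), card F) = z. ?t j m)"
      by (intro sum.cong) (auto simp: z)
    then show "(\<Sum>F | F \<in> ?Fs \<and> (card (\<Union>F), card F) = z. ?t (card (\<Union>F)) (card F)) =
        (case z of (j, m) \<Rightarrow> (-1) ^ m * int (num_bad_choices G j m)
          * int (Stirling_int (N - j) (int k - int m)))"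
      by (simp add: num_bad_choices_def conj_ac z)
  qed simp
  also have "\<dots> = (\<Sum>j=0..n. \<Sum>m=0..j. (-1) ^ m * int (num_bad_choices G j m)
      * int (Stirling_int (N - j) (int k - int m)))"
    by (simp add: sum.Sigma)
  finally show ?thesis .
qed

end
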